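(* Let $G=(V,E,w)$ be a connected undirected weighted graph with $n=|V|$ vertices, maximum degree $D$ (with $D\gg 1$), and real edge weights in $[1,W_{\max}]$, where $V$ and $W_{\max}$ are known but $E$ and $w$ are not. Using only distance queries $q_d(u,v)$ and edge-weight queries $q_w(u,v)$ on $G$ (no threshold), there is a randomized algorithm that reconstructs $E$ and all edge weights with (expected, over the algorithm's randomness) query complexity $\tilde{O}\left(n^{3/2}D^{3W_{\max}}\right)$.
   Context: $q_d(u,v)$ returns the length (sum of edge weights) of a shortest weighted path between $u$ and $v$ in $G$; $q_w(u,v)$ returns $w(u,v)$ if $uv\in E$ and $0$ otherwise. Query complexity is the number of queries issued. $\tilde{O}(\cdot)$ hides polylogarithmic factors in $n$. *)

theory Defs
  imports "HOL-Probability.Probability"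
begin

text \<open>Finite simple undirected graphs: an edge is a two-element set of vertices, and an edge
  weight is a function on edges whose values outside \<open>E\<close> are irrelevant.\<close>

definition weighted_graph :: "'v set \<Rightarrow> 'v set set \<Rightarrow> ('v set \<Rightarrow> real) \<Rightarrow> real \<Rightarrow> bool" where
  "weighted_graph V E w Wmax \<longleftrightarrow>
     finite V \<and> V \<noteq> {} \<and> (\<forall>e\<in>E. e \<subseteq> V \<and> card e = 2) \<and> (\<forall>e\<in>E. 1 \<le> w e \<and> w e \<le> Wmax)"

definition degree :: "'v set set \<Rightarrow> 'v \<Rightarrow> nat" where
  "degree E v = card {e \<in> E. v \<in> e}"

definition max_degree :: "'v set \<Rightarrow> 'v set set \<Rightarrow> nat" where
  "max_degree V E = Max (degree E ` V)"

definition paths :: "'v set \<Rightarrow> 'v set set \<Rightarrow> 'v \<Rightarrow> 'v \<Rightarrow> 'v list set" where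
  "paths V E u v = {xs. xs \<noteq> [] \<and> hd xs = u \<and> last xs = v \<and> distinct xs \<and> set xs \<subseteq> V \<and>
     successively (\<lambda>x y. {x, y} \<in> E) xs}"

definition connected_graph :: "'v set \<Rightarrow> 'v set set \<Rightarrow> bool" where
  "connected_graph V E \<longleftrightarrow> (\<forall>u\<in>V. \<forall>v\<in>V. paths V E u v \<noteq> {})"

definition path_length :: "('v set \<Rightarrow> real) \<Rightarrow> 'v list \<Rightarrow> real" where
  "path_length w xs = (\<Sum>(x, y)\<leftarrow>zip xs (tl xs). w {x, y})"

definition graph_dist :: "'v set \<Rightarrow> 'v set set \<Rightarrow> ('v set \<Rightarrow> real) \<Rightarrow> 'v \<Rightarrow> 'v \<Rightarrow> real" where
  "graph_dist V E w u v = Min (path_length w ` paths V E u v)"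

datatype 'v query = Dist_Query 'v 'v | Weight_Query 'v 'v

text \<open>A query mentioning a vertex outside \<open>V\<close> has an answer independent of \<open>E\<close> and \<open>w\<close>
  (\<open>Min {}\<close> for distances, \<open>0\<close> for weights), so it carries no information about the graph.\<close>

primrec answer :: "'v set \<Rightarrow> 'v set set \<Rightarrow> ('v set \<Rightarrow> real) \<Rightarrow> 'v query \<Rightarrow> real" where
  "answer V E w (Dist_Query u v) = graph_dist V E w u v"
| "answer V E w (Weight_Query u v) = (if {u, v} \<in> E then w {u, v} else 0)"

text \<open>Randomized adaptive query algorithms as well-founded trees: an algorithm stops with an
  output, asks a query and continues depending on the answer, or makes a (discrete) random choice
  of how to continue. Running one against an answering function gives the joint distribution of its output and
  the number of queries issued.\<close>

datatype ('v, 'r) query_alg =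
  Output 'r
| Ask "'v query" "real \<Rightarrow> ('v, 'r) query_alg"
| Choose "('v, 'r) query_alg pmf"

primrec run :: "('v query \<Rightarrow> real) \<Rightarrow> ('v, 'r) query_alg \<Rightarrow> ('r \<times> nat) pmf" where
  "run ans (Output r) = return_pmf (r, 0)"
| "run ans (Ask q k) = map_pmf (\<lambda>(r, c). (r, Suc c)) (run ans (k (ans q)))"
| "run ans (Choose p) = join_pmf (map_pmf (run ans) p)"

definition expected_queries :: "('v query \<Rightarrow> real) \<Rightarrow> ('v, 'r) query_alg \<Rightarrow> ennreal" where
  "expected_queries ans alg = (\<integral>\<^sup>+ (r, c). of_nat c \<partial>measure_pmf (run ans alg))"

definition reconstructs ::
  "'v set \<Rightarrow> 'v set set \<Rightarrow> ('v set \<Rightarrow> real) \<Rightarrow>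
   ('v, 'v set set \<times> ('v set \<Rightarrow> real)) query_alg \<Rightarrow> bool" where
  "reconstructs V E w alg \<longleftrightarrow>
     (\<forall>((E', w'), c) \<in> set_pmf (run (answer V E w) alg). E' = E \<and> (\<forall>e\<in>E. w' e = w e))"

end

theory Submission
  imports Defs
begin

text \<open>Centers \<open>A\<close> are sampled so that every cluster \<open>C(b) = {v. \<forall>a\<in>A. d(b,v) < d(a,v)}\<close> has
  size \<open>O(\<surd>n log n)\<close>. Let \<open>N\<close> be the set of vertices within distance \<open>2 Wmax\<close> of \<open>A\<close>, and let
  \<open>uv\<close> be an edge whose endpoint \<open>u\<close> is at least as close to \<open>A\<close> as \<open>v\<close>. Either \<open>u \<in> N\<close>, or
  the shortest path from the nearest center \<open>a\<close> to \<open>u\<close> contains a vertex \<open>b\<close> with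
  \<open>Wmax < d(a,b) \<le> 2 Wmax\<close>, and then both endpoints lie in \<open>C(b)\<close>. So it is enough to query the
  weights of the pairs in \<open>N \<times> V\<close> and in \<open>C(b) \<times> C(b)\<close> for \<open>b \<in> N\<close>, where
  \<open>card N \<le> 2 D\<^bsup>2 Wmax\<^esup> card A\<close>.

  The centers come from \<open>O(log n)\<close> rounds, in the spirit of Thorup and Zwick. Let \<open>W\<close> be the set of
  vertices whose cluster may still be large. A round draws \<open>2m\<close> new centers from \<open>W\<close> and \<open>m \<approx> \<surd>n\<close>
  test vertices from \<open>V\<close>, and keeps \<open>w \<in> W\<close> only if some test vertex is strictly closer to \<open>w\<close>
  than to all new centers. For each test vertex the expected fraction of kept vertices is at most
  \<open>1/(2m+1)\<close>, so \<open>W\<close> is halved in expectation; and a vertex with a large cluster is dropped only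
  if all test vertices miss that cluster. If \<open>W\<close> does not become empty, or if some cluster is
  still too large, all pairs are queried; this has probability \<open>O(log n / n)\<close>. The algorithm never
  needs to know \<open>D\<close>.\<close>

section \<open>Batches of queries\<close>

primrec ask_list ::
  "'v query list \<Rightarrow> (('v query \<Rightarrow> real) \<Rightarrow> ('v, 'r) query_alg) \<Rightarrow> ('v, 'r) query_alg" where
  "ask_list [] k = k (\<lambda>_. 0)"
| "ask_list (q # qs) k = Ask q (\<lambda>r. ask_list qs (\<lambda>f. k (f(q := r))))"

lemma run_ask_list:
  "run ans (ask_list qs k) =
     map_pmf (\<lambda>(r, c). (r, c + length qs)) (run ans (k (\<lambda>q. if q \<in> set qs then ans q else 0)))"
proof (induction qs arbitrary: k)
  case Nil
  then show ?case by (simp add: case_prod_unfold)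
next
  case (Cons q qs)
  have "(\<lambda>q'. if q' \<in> set qs then ans q' else 0)(q := ans q) =
      (\<lambda>q'. if q' \<in> set (q # qs) then ans q' else 0)"
    by auto
  then show ?case
    by (simp add: Cons.IH pmf.map_comp o_def case_prod_unfold)
qed

text \<open>No query of a batch depends on the answers to the others, so any enumeration will do; a
  distinct one makes the cost exactly \<open>card Q\<close>. Unasked queries read as
  \<open>0\<close>.\<close>

definition ask_set ::
  "'v query set \<Rightarrow> (('v query \<Rightarrow> real) \<Rightarrow> ('v, 'r) query_alg) \<Rightarrow> ('v, 'r) query_alg" where
  "ask_set Q k = ask_list (SOME qs. set qs = Q \<and> distinct qs) k"

lemma run_ask_set:
  assumes "finite Q"
  shows "run ans (ask_set Q k) =
     map_pmf (\<lambda>(r, c). (r, c + card Q)) (run ans (k (\<lambda>q. if q \<in> Q then ans q else 0)))"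
proof -
  define qs where "qs = (SOME qs. set qs = Q \<and> distinct qs)"
  have qs: "set qs = Q \<and> distinct qs"
    unfolding qs_def using finite_distinct_list[OF assms] by (rule someI_ex)
  then have "length qs = card Q" using distinct_card by metis
  then show ?thesis
    using run_ask_list[of ans qs k] qs by (simp add: ask_set_def qs_def[symmetric])
qed

lemma expected_queries_Output [simp]: "expected_queries ans (Output r) = 0"
  by (simp add: expected_queries_def)

lemma expected_queries_ask_set:
  assumes "finite Q"
  shows "expected_queries ans (ask_set Q k) =
    of_nat (card Q) + expected_queries ans (k (\<lambda>q. if q \<in> Q then ans q else 0))"
  by (simp add: expected_queries_def run_ask_set[OF assms] case_prod_unfold nn_integral_add
      measure_pmf.emeasure_space_1 add.commute)

lemma expected_queries_Choose:
  "expected_queries ans (Choose p) = (\<integral>\<^sup>+ a. expected_queries ans a \<partial>measure_pmf p)"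
  by (simp add: expected_queries_def join_eq_bind_pmf bind_map_pmf nn_integral_bind_pmf)

lemma reconstructs_ask_set:
  assumes "finite Q"
  shows "reconstructs V E w (ask_set Q k) \<longleftrightarrow>
    reconstructs V E w (k (\<lambda>q. if q \<in> Q then answer V E w q else 0))"
  by (simp add: reconstructs_def run_ask_set[OF assms] case_prod_unfold)

lemma reconstructs_Choose:
  "reconstructs V E w (Choose p) \<longleftrightarrow> (\<forall>a\<in>set_pmf p. reconstructs V E w a)"
  by (auto simp: reconstructs_def join_eq_bind_pmf bind_map_pmf)

text \<open>Weights are at least 1, so the answer \<open>0\<close> marks a non-edge. If both
  orientations of an edge lie in \<open>P\<close>, true answers agree, so the choice returns its
  weight.\<close>

definition weight_output ::
  "('v \<times> 'v) set \<Rightarrow> ('v query \<Rightarrow> real) \<Rightarrow> 'v set set \<times> ('v set \<Rightarrow> real)" where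
  "weight_output P f =
     ({{u, v} | u v. (u, v) \<in> P \<and> f (Weight_Query u v) \<noteq> 0},
      \<lambda>e. SOME r. \<exists>u v. (u, v) \<in> P \<and> e = {u, v} \<and> r = f (Weight_Query u v))"

definition ask_weights :: "('v \<times> 'v) set \<Rightarrow> ('v, 'v set set \<times> ('v set \<Rightarrow> real)) query_alg" where
  "ask_weights P =
     ask_set ((\<lambda>(u, v). Weight_Query u v) ` P) (\<lambda>f. Output (weight_output P f))"

lemma expected_queries_ask_weights:
  assumes "finite P"
  shows "expected_queries ans (ask_weights P) = of_nat (card P)"
proof -
  have "inj_on (\<lambda>(u, v). Weight_Query u v) P"
    by (auto simp: inj_on_def)
  then show ?thesis
    using assms by (simp add: ask_weights_def expected_queries_ask_set card_image)
qed

lemma reconstructs_ask_weights: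
  assumes "finite P" and nonzero: "\<And>e. e \<in> E \<Longrightarrow> w e \<noteq> 0"
    and cover: "\<And>e. e \<in> E \<Longrightarrow> \<exists>u v. e = {u, v} \<and> (u, v) \<in> P"
  shows "reconstructs V E w (ask_weights P)"
proof -
  define f where "f = (\<lambda>q. if q \<in> (\<lambda>(u, v). Weight_Query u v) ` P then answer V E w q else 0)"
  have f: "f (Weight_Query u v) = (if {u, v} \<in> E then w {u, v} else 0)" if "(u, v) \<in> P" for u v
    using that by (auto simp: f_def image_iff)
  have edges: "fst (weight_output P f) = E"
  proof (intro equalityI subsetI)
    fix e assume "e \<in> fst (weight_output P f)"
    then show "e \<in> E" by (auto simp: weight_output_def f split: if_splits)
  next
    fix e assume e: "e \<in> E"
    then obtain u v where "e = {u, v}" "(u, v) \<in> P" using cover by blast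
    moreover from this have "f (Weight_Query u v) \<noteq> 0"
      using e nonzero[OF e] f[of u v] by simp
    ultimately show "e \<in> fst (weight_output P f)"
      unfolding weight_output_def fst_conv by blast
  qed
  have weights: "snd (weight_output P f) e = w e" if e: "e \<in> E" for e
  proof -
    have "\<exists>r u v. (u, v) \<in> P \<and> e = {u, v} \<and> r = f (Weight_Query u v)"
      using cover[OF e] by blast
    then have "\<exists>u v. (u, v) \<in> P \<and> e = {u, v} \<and> snd (weight_output P f) e = f (Weight_Query u v)"
      unfolding weight_output_def snd_conv by (rule someI_ex)
    then show ?thesis using e f by auto
  qed
  have "reconstructs V E w (Output (weight_output P f))"
    using edges weights by (auto simp: reconstructs_def case_prod_unfold)
  then show ?thesis
    unfolding ask_weights_def f_def using \<open>finite P\<close> by (subst reconstructs_ask_set) auto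
qed

section \<open>Weighted graph distances\<close>

lemma path_length_Cons2 [simp]:
  "path_length w (x # y # xs) = w {x, y} + path_length w (y # xs)"
  by (simp add: path_length_def)

lemma path_length_trivial [simp]: "path_length w [] = 0" "path_length w [x] = 0"
  by (simp_all add: path_length_def)

text \<open>The junction \<open>y\<close> is kept in both parts, so no edge is lost or counted
  twice.\<close>

lemma path_length_append:
  "path_length w (xs @ y # ys) = path_length w (xs @ [y]) + path_length w (y # ys)"
proof (induction xs)
  case (Cons x xs)
  then show ?case by (cases xs) auto
qed simp

lemma path_length_snoc:
  "xs \<noteq> [] \<Longrightarrow> path_length w (xs @ [y]) = path_length w xs + w {last xs, y}"
  by (cases xs rule: rev_cases) (auto simp: path_length_append[of w _ _ "[y]"])

lemma paths_split:
  assumes "ys @ b # zs \<in> paths V E u v"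
  shows "ys @ [b] \<in> paths V E u b" "b # zs \<in> paths V E b v"
  using assms
  by (simp_all add: paths_def hd_append successively_append_iff successively_Cons split: if_splits)

text \<open>This geometric sum over hop counts is the source of the factor 2 in the ball
  sizes.\<close>

lemma sum_powers_le: "2 \<le> (D::nat) \<Longrightarrow> (\<Sum>k\<le>K. D ^ k) \<le> 2 * D ^ K"
proof (induction K)
  case (Suc K)
  have "2 * D ^ K \<le> D * D ^ K" using Suc.prems by (intro mult_right_mono) auto
  then show ?case using Suc.IH[OF Suc.prems] by (simp only: sum.atMost_Suc power_Suc)
qed simp

section \<open>Shortest paths under bounded edge weights\<close>

locale connected_weighted_graph =
  fixes V :: "'v set" and E :: "'v set set" and w :: "'v set \<Rightarrow> real" and Wmax :: real
  assumes graph: "weighted_graph V E w Wmax"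
    and connected: "connected_graph V E"
begin

abbreviation d where "d \<equiv> graph_dist V E w"

lemma finite_V: "finite V" and V_nonempty: "V \<noteq> {}"
  using graph by (auto simp: weighted_graph_def)

lemma weight_bounds: "e \<in> E \<Longrightarrow> 1 \<le> w e" "e \<in> E \<Longrightarrow> w e \<le> Wmax"
  using graph by (auto simp: weighted_graph_def)

lemma edge_card: "e \<in> E \<Longrightarrow> card e = 2"
  using graph by (auto simp: weighted_graph_def)

lemma edge_in_V: "{u, v} \<in> E \<Longrightarrow> u \<in> V" "{u, v} \<in> E \<Longrightarrow> v \<in> V"
  using graph by (auto simp: weighted_graph_def)

lemma finite_E: "finite E"
  by (rule finite_subset[of _ "Pow V"]) (use graph in \<open>auto simp: weighted_graph_def\<close>)

lemma finite_paths: "finite (paths V E u v)"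
  by (rule finite_subset[OF _ finite_subset_distinct[OF finite_V]]) (auto simp: paths_def)

lemma graph_dist_le: "xs \<in> paths V E u v \<Longrightarrow> d u v \<le> path_length w xs"
  by (simp add: graph_dist_def finite_paths)

lemma shortest_path:
  assumes "u \<in> V" "v \<in> V"
  obtains xs where "xs \<in> paths V E u v" "path_length w xs = d u v"
proof -
  have "paths V E u v \<noteq> {}" using assms connected by (auto simp: connected_graph_def)
  then have "d u v \<in> path_length w ` paths V E u v"
    unfolding graph_dist_def by (intro Min_in) (auto simp: finite_paths)
  then show ?thesis using that by auto
qed

lemma graph_dist_self: "u \<in> V \<Longrightarrow> d u u \<le> 0"
  using graph_dist_le[of "[u]" u u] by (simp add: paths_def)

text \<open>Every edge weighs at least 1. This turns a weighted distance into a bound on the number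
  of edges.\<close>

lemma path_length_ge:
  "successively (\<lambda>x y. {x, y} \<in> E) xs \<Longrightarrow> real (length xs) - 1 \<le> path_length w xs"
proof (induction xs rule: induct_list012)
  case (3 x y zs)
  then show ?case using weight_bounds(1)[of "{x, y}"] by auto
qed auto

lemma path_length_nonneg:
  "successively (\<lambda>x y. {x, y} \<in> E) xs \<Longrightarrow> 0 \<le> path_length w xs"
  using path_length_ge[of xs] by (cases xs) auto

lemma graph_dist_edge:
  assumes "b \<in> V" "{u, v} \<in> E"
  shows "d b v \<le> d b u + Wmax"
proof -
  obtain xs where xs: "xs \<in> paths V E b u" "path_length w xs = d b u"
    using shortest_path assms edge_in_V by metis
  have W: "0 \<le> w {u, v}" "w {u, v} \<le> Wmax" using weight_bounds[OF assms(2)] by auto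
  show ?thesis
  proof (cases "v \<in> set xs")
    case True
    \<comment> \<open>Appending \<open>v\<close> would repeat a vertex. The prefix ending in
      \<open>v\<close> is already no longer than \<open>d b u\<close>, because the rest of the path
      has nonnegative length.\<close>
    then obtain ys zs where split: "xs = ys @ v # zs" by (auto simp: in_set_conv_decomp)
    note parts = paths_split[OF xs(1)[unfolded split]]
    have "0 \<le> path_length w (v # zs)"
      using parts(2) by (intro path_length_nonneg) (simp add: paths_def)
    then show ?thesis
      using graph_dist_le[OF parts(1)] xs(2) W path_length_append[of w ys v zs] split by simp
  next
    case False
    have "xs @ [v] \<in> paths V E b v"
      using xs(1) False assms edge_in_V(2)[of u v]
      by (auto simp: paths_def successively_append_iff)
    then show ?thesis
      using graph_dist_le[of "xs @ [v]" b v] path_length_snoc[of xs w v] xs W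
      by (auto simp: paths_def)
  qed
qed

text \<open>The first prefix longer than \<open>Wmax\<close> exceeds it by at most the weight of its
  last edge, hence by at most \<open>Wmax\<close>.\<close>

lemma path_split:
  assumes "successively (\<lambda>x y. {x, y} \<in> E) xs" "0 \<le> Wmax" "Wmax < path_length w xs"
  shows "\<exists>ys b zs. xs = ys @ b # zs \<and> Wmax < path_length w (ys @ [b]) \<and>
    path_length w (ys @ [b]) \<le> 2 * Wmax"
  using assms
proof (induction xs rule: rev_induct)
  case (snoc x xs)
  show ?case
  proof (cases "Wmax < path_length w xs")
    case True
    then obtain ys b zs where "xs = ys @ b # zs" "Wmax < path_length w (ys @ [b])"
      "path_length w (ys @ [b]) \<le> 2 * Wmax"
      using snoc by (auto simp: successively_append_iff)
    then show ?thesis by (intro exI[of _ ys] exI[of _ b] exI[of _ "zs @ [x]"]) auto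
  next
    case False
    have "xs \<noteq> []" using snoc.prems by auto
    then have "{last xs, x} \<in> E" using snoc.prems by (auto simp: successively_append_iff)
    then have "path_length w (xs @ [x]) \<le> 2 * Wmax"
      using path_length_snoc[OF \<open>xs \<noteq> []\<close>, of w x] False weight_bounds(2) by fastforce
    then show ?thesis using snoc.prems by auto
  qed
qed simp

text \<open>A shortest path from \<open>a\<close> to \<open>u\<close> is cut at the vertex given by
  \<open>path_split\<close>; the two parts add up to \<open>d a u\<close> and the first is longer
  than \<open>Wmax\<close>.\<close>

lemma intermediate_vertex:
  assumes "a \<in> V" "u \<in> V" "0 \<le> Wmax" "Wmax < d a u"
  obtains b where "b \<in> V" "d a b \<le> 2 * Wmax" "d b u < d a u - Wmax"
proof -
  obtain xs where xs: "xs \<in> paths V E a u" "path_length w xs = d a u"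
    using shortest_path assms by metis
  then obtain ys b zs where split: "xs = ys @ b # zs"
    and b: "Wmax < path_length w (ys @ [b])" "path_length w (ys @ [b]) \<le> 2 * Wmax"
    using path_split[of xs] assms by (auto simp: paths_def)
  note parts = paths_split[OF xs(1)[unfolded split]]
  have "b \<in> V" using xs(1) by (auto simp: paths_def split)
  then show ?thesis
    using that[of b] parts[THEN graph_dist_le] b xs(2) path_length_append[of w ys b zs] split
    by simp
qed

section \<open>Ball sizes in terms of the maximum degree\<close>

lemma degree_le: "degree E v \<le> max_degree V E"
proof (cases "v \<in> V")
  case True
  then show ?thesis unfolding max_degree_def using finite_V by (intro Max_ge) auto
next
  case False
  then have "{e \<in> E. v \<in> e} = {}" using graph by (auto simp: weighted_graph_def)
  then show ?thesis by (simp only: degree_def card.empty)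
qed

lemma card_neighbours_le: "card {u. {v, u} \<in> E} \<le> max_degree V E"
proof -
  have "inj_on (\<lambda>u. {v, u}) {u. {v, u} \<in> E}" by (auto simp: inj_on_def doubleton_eq_iff)
  then have "card {u. {v, u} \<in> E} \<le> card {e \<in> E. v \<in> e}"
    using finite_E by (intro card_inj_on_le[where f = "\<lambda>u. {v, u}"]) auto
  then show ?thesis using degree_le[of v] by (simp add: degree_def)
qed

lemma finite_neighbours: "finite {u. {v, u} \<in> E}"
  by (rule finite_subset[OF _ finite_V]) (use edge_in_V in auto)

text \<open>Endpoints of walks with exactly \<open>k\<close> edges. They cover the balls, and each
  further edge multiplies their number by at most the maximum degree.\<close>

definition walk_ends :: "'v \<Rightarrow> nat \<Rightarrow> 'v set" where
  "walk_ends a k = {b. \<exists>xs. length xs = Suc k \<and> hd xs = a \<and> last xs = b \<and>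
     successively (\<lambda>x y. {x, y} \<in> E) xs}"

lemma card_walk_ends: "finite (walk_ends a k) \<and> card (walk_ends a k) \<le> max_degree V E ^ k"
proof (induction k)
  case 0
  have "walk_ends a 0 \<subseteq> {a}" by (auto simp: walk_ends_def length_Suc_conv)
  then show ?case using card_mono[of "{a}"] finite_subset by fastforce
next
  case (Suc k)
  have sub: "walk_ends a (Suc k) \<subseteq> (\<Union>v\<in>walk_ends a k. {u. {v, u} \<in> E})"
  proof
    fix b assume "b \<in> walk_ends a (Suc k)"
    then obtain xs where xs: "length xs = Suc (Suc k)" "hd xs = a" "last xs = b"
      "successively (\<lambda>x y. {x, y} \<in> E) xs"
      by (auto simp: walk_ends_def)
    then obtain ys where ys: "xs = ys @ [b]" "length ys = Suc k"
      by (cases xs rule: rev_cases) auto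
    moreover from this have "ys \<noteq> []" by auto
    ultimately have "hd ys = a" "successively (\<lambda>x y. {x, y} \<in> E) ys" "{last ys, b} \<in> E"
      using xs by (simp_all add: successively_append_iff)
    moreover from this have "last ys \<in> walk_ends a k"
      unfolding walk_ends_def using ys by blast
    ultimately show "b \<in> (\<Union>v\<in>walk_ends a k. {u. {v, u} \<in> E})" by auto
  qed
  have fin: "finite (\<Union>v\<in>walk_ends a k. {u. {v, u} \<in> E})"
    using Suc finite_neighbours by auto
  have "card (walk_ends a (Suc k)) \<le> card (\<Union>v\<in>walk_ends a k. {u. {v, u} \<in> E})"
    by (rule card_mono[OF fin sub])
  also have "\<dots> \<le> (\<Sum>v\<in>walk_ends a k. card {u. {v, u} \<in> E})"
    using Suc by (intro card_UN_le) auto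
  also have "\<dots> \<le> (\<Sum>v\<in>walk_ends a k. max_degree V E)"
    by (intro sum_mono card_neighbours_le)
  also have "\<dots> \<le> max_degree V E ^ Suc k" using Suc by simp
  finally show ?case using finite_subset[OF sub fin] by simp
qed

text \<open>With weights at least 1, a vertex within distance \<open>r\<close> is reached by at most
  \<open>K\<close>, the floor of \<open>r\<close>, edges; the walk ends are then summed over all hop
  counts up to \<open>K\<close>.\<close>

lemma card_ball_le:
  assumes "2 \<le> max_degree V E" "0 \<le> r" "a \<in> V"
  shows "real (card {b \<in> V. d a b \<le> r}) \<le> 2 * real (max_degree V E) powr r"
proof -
  define K where "K = nat \<lfloor>r\<rfloor>"
  have K: "real K \<le> r" using assms by (simp add: K_def)
  have sub: "{b \<in> V. d a b \<le> r} \<subseteq> (\<Union>k\<le>K. walk_ends a k)"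
  proof
    fix b assume "b \<in> {b \<in> V. d a b \<le> r}"
    then have b: "b \<in> V" "d a b \<le> r" by auto
    obtain xs where xs: "xs \<in> paths V E a b" "path_length w xs = d a b"
      using shortest_path[OF assms(3) b(1)] by metis
    then have "real (length xs - 1) \<le> r" "0 < length xs"
      using path_length_ge[of xs] b(2) by (auto simp: paths_def of_nat_diff Suc_leI)
    then have "length xs - 1 \<le> K" unfolding K_def by (intro le_nat_floor)
    moreover have "b \<in> walk_ends a (length xs - 1)"
      using xs(1) by (auto simp: paths_def walk_ends_def intro!: exI[of _ xs])
    ultimately show "b \<in> (\<Union>k\<le>K. walk_ends a k)" by blast
  qed
  have "card {b \<in> V. d a b \<le> r} \<le> card (\<Union>k\<le>K. walk_ends a k)"
    using sub card_walk_ends by (intro card_mono) auto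
  also have "\<dots> \<le> (\<Sum>k\<le>K. card (walk_ends a k))" by (intro card_UN_le) auto
  also have "\<dots> \<le> (\<Sum>k\<le>K. max_degree V E ^ k)" using card_walk_ends by (intro sum_mono) auto
  also have "\<dots> \<le> 2 * max_degree V E ^ K" by (rule sum_powers_le) (rule assms)
  finally have "real (card {b \<in> V. d a b \<le> r}) \<le> real (2 * max_degree V E ^ K)"
    by (rule of_nat_mono)
  also have "\<dots> = 2 * real (max_degree V E) powr real K"
    using assms(1) by (simp add: powr_realpow)
  also have "\<dots> \<le> 2 * real (max_degree V E) powr r"
    using assms(1) K by (intro mult_left_mono powr_mono) auto
  finally show ?thesis .
qed

end

section \<open>Random samples and clusters\<close>

text \<open>The left side consists of the first two terms of the binomial expansion of the right
  side.\<close>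

lemma add_mult_power_le: "(M::nat) ^ Suc t + Suc t * M ^ t \<le> Suc M ^ Suc t"
proof (induction t)
  case (Suc t)
  have "M ^ Suc (Suc t) + Suc (Suc t) * M ^ Suc t \<le> Suc M * (M ^ Suc t + Suc t * M ^ t)"
    by (simp add: algebra_simps)
  also have "\<dots> \<le> Suc M * Suc M ^ Suc t" by (rule mult_left_mono[OF Suc]) simp
  finally show ?case by simp
qed simp

text \<open>With \<open>t\<close> independent uniform samples from \<open>S\<close>, this says that the expected number of \<open>w \<in> S\<close>
  whose \<open>g\<close>-value is below that of all samples is at most \<open>card S / (t + 1)\<close>.\<close>

lemma sum_rank_power_le:
  fixes g :: "'a \<Rightarrow> real"
  assumes "finite S"
  shows "Suc t * (\<Sum>w\<in>S. card {a \<in> S. g w < g a} ^ t) \<le> card S ^ Suc t"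
  using assms
proof (induction rule: finite_ranking_induct[where f = "\<lambda>x. - g x"])
  case (insert x S)
  show ?case
  proof (cases "x \<in> S")
    case True
    then show ?thesis using insert.IH by (simp add: insert_absorb)
  next
    case False
    \<comment> \<open>Elements are inserted by decreasing \<open>g\<close>, so the new
      \<open>x\<close> has the least value: it enters none of the counted sets, and its own set lies
      in \<open>S\<close>.\<close>
    have "{a \<in> insert x S. g w < g a} = {a \<in> S. g w < g a}" if "w \<in> insert x S" for w
      using insert.hyps that by force
    then have "(\<Sum>w\<in>insert x S. card {a \<in> insert x S. g w < g a} ^ t) =
        card {a \<in> S. g x < g a} ^ t + (\<Sum>w\<in>S. card {a \<in> S. g w < g a} ^ t)"
      using insert.hyps False by (simp cong: sum.cong)
    moreover have "card {a \<in> S. g x < g a} ^ t \<le> card S ^ t"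
      using insert.hyps by (intro power_mono card_mono) auto
    ultimately have "Suc t * (\<Sum>w\<in>insert x S. card {a \<in> insert x S. g w < g a} ^ t) \<le>
        card S ^ Suc t + Suc t * card S ^ t"
      using insert.IH mult_le_mono2[of _ _ "Suc t"] by (simp only: distrib_left) fastforce
    also have "\<dots> \<le> Suc (card S) ^ Suc t" by (rule add_mult_power_le)
    finally show ?thesis using insert.hyps False by simp
  qed
qed simp

lemma emeasure_replicate_pmf_subset:
  "emeasure (measure_pmf (replicate_pmf t p)) {xs. set xs \<subseteq> S} = emeasure (measure_pmf p) S ^ t"
proof (induction t)
  case (Suc t)
  have "emeasure (measure_pmf (replicate_pmf (Suc t) p)) {xs. set xs \<subseteq> S} =
      (\<integral>\<^sup>+ xs. indicator {xs. set xs \<subseteq> S} xs \<partial>measure_pmf (replicate_pmf (Suc t) p))"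
    by simp
  also have "\<dots> = (\<integral>\<^sup>+ x. \<integral>\<^sup>+ xs. indicator {xs. set xs \<subseteq> S} (x # xs)
      \<partial>measure_pmf (replicate_pmf t p) \<partial>measure_pmf p)"
    by (simp add: nn_integral_bind_pmf del: nn_integral_indicator)
  also have "\<dots> = (\<integral>\<^sup>+ x. \<integral>\<^sup>+ xs. indicator S x * indicator {xs. set xs \<subseteq> S} xs
      \<partial>measure_pmf (replicate_pmf t p) \<partial>measure_pmf p)"
    by (intro nn_integral_cong) (auto simp: indicator_def)
  also have "\<dots> = emeasure (measure_pmf p) S ^ Suc t"
    by (simp add: nn_integral_cmult nn_integral_multc Suc.IH)
  finally show ?case .
qed simp

lemma emeasure_pmf_of_set_eq:
  assumes "finite W" "W \<noteq> {}"
  shows "emeasure (measure_pmf (pmf_of_set W)) S = ennreal (real (card (W \<inter> S)) / real (card W))"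
  using assms by (simp add: emeasure_pmf_of_set)

section \<open>Clusters and the survival test\<close>

definition survivors :: "('v \<Rightarrow> 'v \<Rightarrow> real) \<Rightarrow> 'v set \<Rightarrow> 'v list \<Rightarrow> 'v list \<Rightarrow> 'v set" where
  "survivors d W ys xs = {w \<in> W. \<exists>x\<in>set xs. \<forall>a\<in>set ys. d w x < d a x}"

text \<open>The cluster of Thorup and Zwick. It shrinks as centers are added, and a vertex of
  \<open>A\<close> has the empty cluster.\<close>

definition cluster :: "'v set \<Rightarrow> ('v \<Rightarrow> 'v \<Rightarrow> real) \<Rightarrow> 'v set \<Rightarrow> 'v \<Rightarrow> 'v set" where
  "cluster V d A b = {v \<in> V. \<forall>a\<in>A. d b v < d a v}"

text \<open>For a fixed test vertex \<open>x\<close>, a vertex \<open>w\<close> survives through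
  \<open>x\<close> only if its distance to \<open>x\<close> is below that of all \<open>t\<close>
  samples, which the rank bound limits to \<open>card W / (t + 1)\<close> vertices in expectation. A
  union bound over at most \<open>t / 2\<close> test vertices leaves half of
  \<open>W\<close>.\<close>

lemma expected_card_survivors:
  assumes "finite W" "W \<noteq> {}" "2 * length xs \<le> t"
  shows "(\<integral>\<^sup>+ ys. of_nat (card (survivors d W ys xs))
    \<partial>measure_pmf (replicate_pmf t (pmf_of_set W))) \<le> ennreal (real (card W) / 2)"
proof -
  let ?p = "measure_pmf (replicate_pmf t (pmf_of_set W))" and ?M = "real (card W)"
  have M: "0 < ?M" using assms by (simp add: card_gt_0_iff)
  have pointwise: "of_nat (card (survivors d W ys xs)) \<le>
      (\<Sum>x\<in>set xs. \<Sum>w\<in>W. indicator {ys. set ys \<subseteq> {a. d w x < d a x}} ys :: ennreal)" for ys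
  proof -
    have "card (survivors d W ys xs) \<le> card (\<Union>x\<in>set xs. {w \<in> W. set ys \<subseteq> {a. d w x < d a x}})"
      using assms by (intro card_mono) (auto simp: survivors_def)
    also have "\<dots> \<le> (\<Sum>x\<in>set xs. card {w \<in> W. set ys \<subseteq> {a. d w x < d a x}})"
      by (intro card_UN_le) auto
    finally have "(of_nat (card (survivors d W ys xs)) :: ennreal) \<le>
        of_nat (\<Sum>x\<in>set xs. card {w \<in> W. set ys \<subseteq> {a. d w x < d a x}})"
      by (rule of_nat_mono)
    also have "\<dots> = (\<Sum>x\<in>set xs. \<Sum>w\<in>W. indicator {ys. set ys \<subseteq> {a. d w x < d a x}} ys)"
      using assms(1) by (simp add: indicator_def sum.If_cases Int_def)
    finally show ?thesis .
  qed
  \<comment> \<open>The rank bound for \<open>g\<close> the distance to \<open>x\<close>, divided by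
    \<open>card W ^ t\<close> to become a sum of probabilities.\<close>
  have row: "(\<Sum>w\<in>W. (real (card (W \<inter> {a. d w x < d a x})) / ?M) ^ t) \<le> ?M / real (Suc t)" for x
  proof -
    have "real (Suc t * (\<Sum>w\<in>W. card {a \<in> W. d w x < d a x} ^ t)) \<le> real (card W ^ Suc t)"
      using sum_rank_power_le[OF assms(1), of t "\<lambda>a. d a x"] by (rule of_nat_mono)
    then have "real (Suc t) * (\<Sum>w\<in>W. real (card (W \<inter> {a. d w x < d a x})) ^ t) \<le> ?M * ?M ^ t"
      unfolding of_nat_mult of_nat_sum of_nat_power power_Suc by (simp only: Int_def mem_Collect_eq)
    then show ?thesis
      unfolding power_divide sum_divide_distrib[symmetric]
      using M by (simp add: divide_le_eq le_divide_eq mult.commute mult.left_commute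
          del: of_nat_Suc)
  qed
  have "(\<integral>\<^sup>+ ys. of_nat (card (survivors d W ys xs)) \<partial>?p) \<le>
      (\<integral>\<^sup>+ ys. (\<Sum>x\<in>set xs. \<Sum>w\<in>W. indicator {ys. set ys \<subseteq> {a. d w x < d a x}} ys) \<partial>?p)"
    by (intro nn_integral_mono pointwise)
  also have "\<dots> = (\<Sum>x\<in>set xs. \<Sum>w\<in>W. emeasure ?p {ys. set ys \<subseteq> {a. d w x < d a x}})"
    by (simp add: nn_integral_sum)
  also have "\<dots> = (\<Sum>x\<in>set xs. ennreal (\<Sum>w\<in>W. (real (card (W \<inter> {a. d w x < d a x})) / ?M) ^ t))"
    using assms by (simp add: emeasure_replicate_pmf_subset emeasure_pmf_of_set_eq ennreal_power)
  also have "\<dots> \<le> (\<Sum>x\<in>set xs. ennreal (?M / real (Suc t)))"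
    by (intro sum_mono ennreal_leI row)
  also have "\<dots> = ennreal (real (card (set xs)) * (?M / real (Suc t)))"
    by (simp only: sum_constant ennreal_of_nat_eq_real_of_nat ennreal_mult of_nat_0_le_iff
        divide_nonneg_nonneg)
  also have "\<dots> \<le> ennreal (?M / 2)"
  proof (rule ennreal_leI)
    have "2 * card (set xs) \<le> Suc t" using assms(3) card_length[of xs] by simp
    then have "2 * real (card (set xs)) \<le> real (Suc t)" by linarith
    then show "real (card (set xs)) * (?M / real (Suc t)) \<le> ?M / 2"
      using M mult_right_mono[of "2 * real (card (set xs))" "real (Suc t)" ?M]
      by (simp add: field_simps del: of_nat_Suc)
  qed
  finally show ?thesis .
qed

text \<open>With \<open>p\<close> the fraction of \<open>V\<close> in \<open>C\<close>, independence
  gives \<open>(1 - p) ^ m\<close>, which is at most \<open>exp (- m * p)\<close> and so at most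
  \<open>exp (- s)\<close>. Passing from base \<open>exp 1\<close> to base 2 only enlarges the
  bound.\<close>

lemma prob_miss_large_set:
  assumes "finite V" "V \<noteq> {}" "C \<subseteq> V" "card V * s \<le> m * card C"
  shows "emeasure (measure_pmf (replicate_pmf m (pmf_of_set V))) {xs. set xs \<subseteq> - C} \<le>
    ennreal (1 / 2 ^ s)"
proof -
  have n: "0 < card V" using assms by (simp add: card_gt_0_iff)
  have "card (V \<inter> - C) = card V - card C"
    using assms by (simp add: Diff_eq[symmetric] card_Diff_subset finite_subset)
  moreover have "card C \<le> card V" using assms by (intro card_mono) auto
  ultimately have "real (card (V \<inter> - C)) / real (card V) = 1 - real (card C) / real (card V)"
    using n by (simp add: of_nat_diff field_simps)
  moreover have "\<dots> \<le> exp (- (real (card C) / real (card V)))"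
    using exp_ge_add_one_self[of "- (real (card C) / real (card V))"] by simp
  ultimately have "real (card (V \<inter> - C)) / real (card V) \<le> exp (- (real (card C) / real (card V)))"
    by simp
  then have "(real (card (V \<inter> - C)) / real (card V)) ^ m \<le>
      exp (- (real (card C) / real (card V))) ^ m"
    by (rule power_mono) simp
  also have "\<dots> = exp (- (real m * real (card C) / real (card V)))"
    by (simp add: exp_of_nat_mult[symmetric])
  also have "\<dots> \<le> exp (- real s)"
  proof -
    have "real (card V) * real s \<le> real m * real (card C)"
      using assms(4) by (metis of_nat_le_iff of_nat_mult)
    then show ?thesis using n by (simp add: field_simps)
  qed
  also have "\<dots> = (1 / exp 1) ^ s"
    by (simp add: exp_minus exp_of_nat_mult[of s "1::real", simplified] field_simps power_divide)
  also have "\<dots> \<le> (1 / 2) ^ s"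
    using exp_ge_add_one_self[of "1::real"] by (intro power_mono) (auto simp: field_simps)
  finally show ?thesis
    using assms n
    by (simp add: emeasure_replicate_pmf_subset emeasure_pmf_of_set_eq ennreal_power power_divide
        ennreal_leI)
qed

text \<open>Only the middle condition depends on \<open>xs\<close>, so the event is empty or means
  that \<open>w\<close> was dropped. Then all tests miss the cluster with respect to
  \<open>set ys\<close>, hence also the smaller one with respect to
  \<open>A \<union> set ys\<close>, which is large.\<close>

lemma prob_large_cluster_dropped:
  assumes "finite V" "V \<noteq> {}" "card V * s \<le> m * T"
  shows "emeasure (measure_pmf (replicate_pmf m (pmf_of_set V)))
    {xs. w \<in> W \<and> w \<notin> survivors d W ys xs \<and> T < card (cluster V d (A \<union> set ys) w)} \<le>
    ennreal (1 / 2 ^ s)"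
proof (cases "w \<in> W \<and> T < card (cluster V d (A \<union> set ys) w)")
  case True
  have "m * T \<le> m * card (cluster V d (A \<union> set ys) w)" using True by simp
  then have le: "card V * s \<le> m * card (cluster V d (A \<union> set ys) w)" using assms(3) by linarith
  have "{xs. w \<in> W \<and> w \<notin> survivors d W ys xs \<and> T < card (cluster V d (A \<union> set ys) w)} \<subseteq>
      {xs. set xs \<subseteq> - cluster V d (A \<union> set ys) w}"
    using True by (auto simp: survivors_def cluster_def)
  then have "emeasure (measure_pmf (replicate_pmf m (pmf_of_set V)))
      {xs. w \<in> W \<and> w \<notin> survivors d W ys xs \<and> T < card (cluster V d (A \<union> set ys) w)} \<le>
    emeasure (measure_pmf (replicate_pmf m (pmf_of_set V)))
      {xs. set xs \<subseteq> - cluster V d (A \<union> set ys) w}"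
    by (intro emeasure_mono) auto
  also have "\<dots> \<le> ennreal (1 / 2 ^ s)"
    using assms le by (intro prob_miss_large_set) (auto simp: cluster_def)
  finally show ?thesis .
next
  case False
  then have "{xs. w \<in> W \<and> w \<notin> survivors d W ys xs \<and> T < card (cluster V d (A \<union> set ys) w)} = {}"
    by auto
  then show ?thesis by (simp only: emeasure_empty zero_le)
qed

text \<open>The vertices that a test has wrongly dropped.\<close>

definition large_settled :: "'v set \<Rightarrow> ('v \<Rightarrow> 'v \<Rightarrow> real) \<Rightarrow> nat \<Rightarrow> 'v set \<Rightarrow> 'v set \<Rightarrow> 'v set" where
  "large_settled V d T A W = {w \<in> V - W. T < card (cluster V d A w)}"

lemma card_cluster_antimono:
  "finite V \<Longrightarrow> A \<subseteq> B \<Longrightarrow> card (cluster V d B w) \<le> card (cluster V d A w)"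
  by (intro card_mono) (auto simp: cluster_def)

text \<open>Clusters only shrink, so a vertex settled earlier cannot become large; new contributions
  come from \<open>W\<close>, each with probability at most \<open>1 / 2 ^ s\<close>.\<close>

lemma expected_card_large_settled:
  assumes "finite V" "V \<noteq> {}" "W \<subseteq> V" "card V * s \<le> m * T"
  shows "(\<integral>\<^sup>+ xs. of_nat (card (large_settled V d T (A \<union> set ys) (survivors d W ys xs)))
      \<partial>measure_pmf (replicate_pmf m (pmf_of_set V))) \<le>
    of_nat (card (large_settled V d T A W)) + ennreal (real (card V) / 2 ^ s)"
proof -
  let ?q = "measure_pmf (replicate_pmf m (pmf_of_set V))"
  let ?B = "\<lambda>w. {xs. w \<in> W \<and> w \<notin> survivors d W ys xs \<and> T < card (cluster V d (A \<union> set ys) w)}"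
  have finW: "finite W" using assms finite_subset by blast
  have pointwise: "of_nat (card (large_settled V d T (A \<union> set ys) (survivors d W ys xs))) \<le>
      of_nat (card (large_settled V d T A W)) + (\<Sum>w\<in>W. indicator (?B w) xs :: ennreal)" for xs
  proof -
    have "large_settled V d T (A \<union> set ys) (survivors d W ys xs) \<subseteq>
        large_settled V d T A W \<union> {w \<in> W. xs \<in> ?B w}"
      using card_cluster_antimono[OF assms(1), of A "A \<union> set ys" d]
      by (auto simp: large_settled_def intro: less_le_trans)
    then have "card (large_settled V d T (A \<union> set ys) (survivors d W ys xs)) \<le>
        card (large_settled V d T A W \<union> {w \<in> W. xs \<in> ?B w})"
      using assms finW by (intro card_mono) (auto simp: large_settled_def)
    also have "\<dots> \<le> card (large_settled V d T A W) + card {w \<in> W. xs \<in> ?B w}"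
      by (rule card_Un_le)
    finally have "(of_nat (card (large_settled V d T (A \<union> set ys) (survivors d W ys xs))) :: ennreal)
        \<le> of_nat (card (large_settled V d T A W) + card {w \<in> W. xs \<in> ?B w})"
      by (rule of_nat_mono)
    also have "\<dots> = of_nat (card (large_settled V d T A W)) + of_nat (card {w \<in> W. xs \<in> ?B w})"
      by simp
    also have "of_nat (card {w \<in> W. xs \<in> ?B w}) = (\<Sum>w\<in>W. indicator (?B w) xs :: ennreal)"
      using finW by (simp only: indicator_def of_bool_def) (simp add: sum.If_cases Int_def)
    finally show ?thesis .
  qed
  have "(\<integral>\<^sup>+ xs. of_nat (card (large_settled V d T (A \<union> set ys) (survivors d W ys xs))) \<partial>?q) \<le>
      (\<integral>\<^sup>+ xs. of_nat (card (large_settled V d T A W)) + (\<Sum>w\<in>W. indicator (?B w) xs) \<partial>?q)"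
    by (intro nn_integral_mono pointwise)
  also have "\<dots> = of_nat (card (large_settled V d T A W)) + (\<Sum>w\<in>W. emeasure ?q (?B w))"
    by (simp add: nn_integral_add nn_integral_sum measure_pmf.emeasure_space_1)
  also have "\<dots> \<le> of_nat (card (large_settled V d T A W)) + (\<Sum>w\<in>W. ennreal (1 / 2 ^ s))"
    using assms by (intro add_left_mono sum_mono prob_large_cluster_dropped) auto
  also have "(\<Sum>w\<in>W. ennreal (1 / 2 ^ s)) \<le> ennreal (real (card V) / 2 ^ s)"
  proof -
    have "card W \<le> card V" using assms by (intro card_mono) auto
    then show ?thesis
      by (simp add: ennreal_of_nat_eq_real_of_nat ennreal_mult[symmetric] divide_right_mono ennreal_leI)
  qed
  finally show ?thesis by (simp add: add_left_mono)
qed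

section \<open>The algorithm\<close>

definition dist_queries :: "'v set \<Rightarrow> 'v set \<Rightarrow> 'v query set" where
  "dist_queries A B = (\<lambda>(u, v). Dist_Query u v) ` (A \<times> B)"

lemma Dist_Query_in_dist_queries [simp]: "Dist_Query u v \<in> dist_queries A B \<longleftrightarrow> u \<in> A \<and> v \<in> B"
  by (auto simp: dist_queries_def)

lemma finite_dist_queries [simp]: "finite A \<Longrightarrow> finite B \<Longrightarrow> finite (dist_queries A B)"
  by (simp add: dist_queries_def)

lemma card_dist_queries: "card (dist_queries A B) = card A * card B"
proof -
  have "inj_on (\<lambda>(u, v). Dist_Query u v) (A \<times> B)" by (auto simp: inj_on_def)
  then show ?thesis by (simp add: dist_queries_def card_image card_cartesian_product)
qed

text \<open>Falling back to all pairs when a cluster is too large keeps the output correct for every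
  random outcome; bad luck affects only the cost.\<close>

definition candidate_pairs ::
  "'v set \<Rightarrow> nat \<Rightarrow> 'v set \<Rightarrow> 'v set \<Rightarrow> ('v \<Rightarrow> 'v \<Rightarrow> real) \<Rightarrow> ('v \<times> 'v) set" where
  "candidate_pairs V T A N d =
     (if \<forall>b\<in>N. card (cluster V d A b) \<le> T
      then N \<times> V \<union> (\<Union>b\<in>N. cluster V d A b \<times> cluster V d A b) else V \<times> V)"

text \<open>A cluster of \<open>b \<in> N\<close> compares distances from \<open>b\<close> with
  distances from centers. As \<open>A \<subseteq> N\<close>, the answers on
  \<open>N \<times> V\<close> determine it.\<close>

lemma candidate_pairs_cong:
  assumes "A \<subseteq> N" "\<And>b v. b \<in> N \<Longrightarrow> v \<in> V \<Longrightarrow> d b v = d' b v"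
  shows "candidate_pairs V T A N d = candidate_pairs V T A N d'"
proof -
  have "cluster V d A b = cluster V d' A b" if "b \<in> N" for b
    using that assms by (fastforce simp: cluster_def)
  then show ?thesis by (simp add: candidate_pairs_def)
qed

lemma candidate_pairs_subset: "N \<subseteq> V \<Longrightarrow> candidate_pairs V T A N d \<subseteq> V \<times> V"
  by (auto simp: candidate_pairs_def cluster_def)

text \<open>The fallback happens only if some cluster exceeds \<open>T\<close>, so its cost is
  charged to the number of such vertices, a quantity whose expectation can be followed through the
  rounds.\<close>

lemma card_candidate_pairs:
  assumes "finite V" "N \<subseteq> V"
  shows "card (candidate_pairs V T A N d) \<le>
    card N * card V + card N * T\<^sup>2 + (card V)\<^sup>2 * card (large_settled V d T A {})"
proof (cases "\<forall>b\<in>N. card (cluster V d A b) \<le> T")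
  case True
  have fin: "finite N" using assms finite_subset by blast
  have "card (\<Union>b\<in>N. cluster V d A b \<times> cluster V d A b) \<le>
      (\<Sum>b\<in>N. card (cluster V d A b \<times> cluster V d A b))"
    using fin by (rule card_UN_le)
  also have "\<dots> \<le> (\<Sum>b\<in>N. T\<^sup>2)"
    using True by (intro sum_mono) (simp add: card_cartesian_product power2_eq_square mult_le_mono)
  finally have "card (\<Union>b\<in>N. cluster V d A b \<times> cluster V d A b) \<le> card N * T\<^sup>2" by simp
  then show ?thesis
    using True card_Un_le[of "N \<times> V" "\<Union>b\<in>N. cluster V d A b \<times> cluster V d A b"]
    by (simp add: candidate_pairs_def card_cartesian_product)
next
  case False
  then have "large_settled V d T A {} \<noteq> {}" using assms by (auto simp: large_settled_def not_le)
  moreover have "finite (large_settled V d T A {})" using assms by (simp add: large_settled_def)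
  ultimately have "1 \<le> card (large_settled V d T A {})" by (simp add: Suc_leI card_gt_0_iff)
  then have "(card V)\<^sup>2 * 1 \<le> (card V)\<^sup>2 * card (large_settled V d T A {})" by (intro mult_le_mono2)
  moreover have "card (candidate_pairs V T A N d) = (card V)\<^sup>2"
    unfolding candidate_pairs_def if_not_P[OF False]
    by (simp add: card_cartesian_product power2_eq_square)
  ultimately show ?thesis by linarith
qed

definition reconstruct_from_centers ::
  "'v set \<Rightarrow> real \<Rightarrow> nat \<Rightarrow> 'v set \<Rightarrow> ('v, 'v set set \<times> ('v set \<Rightarrow> real)) query_alg" where
  "reconstruct_from_centers V Wmax T A =
     ask_set (dist_queries A V) (\<lambda>f.
       let N = {b \<in> V. \<exists>a\<in>A. f (Dist_Query a b) \<le> 2 * Wmax} in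
       ask_set (dist_queries N V) (\<lambda>g.
         ask_weights (candidate_pairs V T A N (\<lambda>u v. g (Dist_Query u v)))))"

text \<open>\<open>A\<close> is the set of centers drawn so far and \<open>W\<close> the set of vertices whose cluster has not yet
  passed the test.\<close>

primrec center_rounds ::
  "'v set \<Rightarrow> real \<Rightarrow> nat \<Rightarrow> nat \<Rightarrow> nat \<Rightarrow> 'v set \<Rightarrow> 'v set \<Rightarrow>
   ('v, 'v set set \<times> ('v set \<Rightarrow> real)) query_alg" where
  "center_rounds V Wmax m T 0 A W =
     (if W = {} then reconstruct_from_centers V Wmax T A else ask_weights (V \<times> V))"
| "center_rounds V Wmax m T (Suc j) A W =
     (if W = {} then reconstruct_from_centers V Wmax T A
      else Choose (map_pmf (\<lambda>(ys, xs). ask_set (dist_queries V (set xs)) (\<lambda>f.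
          center_rounds V Wmax m T j (A \<union> set ys) (survivors (\<lambda>u v. f (Dist_Query u v)) W ys xs)))
        (pair_pmf (replicate_pmf (2 * m) (pmf_of_set W)) (replicate_pmf m (pmf_of_set V)))))"

lemma survivors_cong:
  assumes "W \<subseteq> V" "set ys \<subseteq> V" "\<And>u x. u \<in> V \<Longrightarrow> x \<in> set xs \<Longrightarrow> d u x = d' u x"
  shows "survivors d W ys xs = survivors d' W ys xs"
proof -
  have "d w x < d a x \<longleftrightarrow> d' w x < d' a x" if "w \<in> W" "x \<in> set xs" "a \<in> set ys" for w x a
    using that assms by (metis subsetD)
  then show ?thesis unfolding survivors_def by blast
qed

lemma in_set_replicate_pmf_of_set:
  assumes "xs \<in> set_pmf (replicate_pmf t (pmf_of_set W))" "finite W" "W \<noteq> {}"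
  shows "set xs \<subseteq> W" "length xs = t"
  using assms by (auto simp: set_replicate_pmf)

text \<open>Survivors are bounded over random centers with the tests fixed, wrongly dropped vertices
  over random tests with the centers fixed, so both orders of integration occur.\<close>

lemma nn_integral_pair_pmf_swap:
  "(\<integral>\<^sup>+ z. f z \<partial>measure_pmf (pair_pmf p q)) =
     (\<integral>\<^sup>+ y. \<integral>\<^sup>+ x. f (x, y) \<partial>measure_pmf p \<partial>measure_pmf q)"
  by (subst pair_commute_pmf) (simp add: nn_integral_pair_pmf' case_prod_unfold)

lemma nn_integral_pmf_const_bound:
  fixes c :: ennreal
  assumes "\<And>x. x \<in> set_pmf p \<Longrightarrow> f x \<le> c"
  shows "(\<integral>\<^sup>+ x. f x \<partial>measure_pmf p) \<le> c"
proof -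
  have "(\<integral>\<^sup>+ x. f x \<partial>measure_pmf p) \<le> (\<integral>\<^sup>+ x. c \<partial>measure_pmf p)"
    using assms by (intro nn_integral_mono_AE) (simp add: AE_measure_pmf_iff)
  then show ?thesis by (simp add: measure_pmf.emeasure_space_1)
qed

section \<open>Correctness, and the cost once the centers are fixed\<close>

context connected_weighted_graph
begin

definition near :: "'v set \<Rightarrow> 'v set" where
  "near A = {b \<in> V. \<exists>a\<in>A. d a b \<le> 2 * Wmax}"

lemma near_subset: "near A \<subseteq> V"
  by (auto simp: near_def)

lemma subset_near: "A \<subseteq> V \<Longrightarrow> 0 \<le> Wmax \<Longrightarrow> A \<subseteq> near A"
  using order_trans[OF graph_dist_self, of _ "2 * Wmax"] by (auto simp: near_def)

lemma card_near_le:
  assumes "A \<subseteq> V" "2 \<le> max_degree V E" "0 \<le> Wmax"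
  shows "real (card (near A)) \<le> real (card A) * (2 * real (max_degree V E) powr (2 * Wmax))"
proof -
  have fin: "finite A" using assms finite_V finite_subset by blast
  have "near A = (\<Union>a\<in>A. {b \<in> V. d a b \<le> 2 * Wmax})" by (auto simp: near_def)
  then have "card (near A) \<le> (\<Sum>a\<in>A. card {b \<in> V. d a b \<le> 2 * Wmax})"
    using card_UN_le[OF fin] by simp
  then have "real (card (near A)) \<le> (\<Sum>a\<in>A. real (card {b \<in> V. d a b \<le> 2 * Wmax}))"
    by (simp flip: of_nat_sum)
  also have "\<dots> \<le> (\<Sum>a\<in>A. 2 * real (max_degree V E) powr (2 * Wmax))"
    using assms by (intro sum_mono card_ball_le) auto
  finally show ?thesis by simp
qed

lemma candidate_pairs_cover:
  assumes "A \<subseteq> V" "A \<noteq> {}" "0 \<le> Wmax" "e \<in> E"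
  shows "\<exists>u v. e = {u, v} \<and> (u, v) \<in> candidate_pairs V T A (near A) d"
proof -
  obtain u0 v0 where e0: "e = {u0, v0}" using edge_card[OF assms(4)] by (meson card_2_iff)
  have "finite (A \<times> e)" "A \<times> e \<noteq> {}"
    using assms finite_V finite_subset e0 by (auto intro: finite_subset)
  \<comment> \<open>The minimum is over centers and endpoints together, so \<open>u\<close> is the
    endpoint closer to \<open>A\<close> and no center is closer than \<open>d a u\<close> to either
    endpoint.\<close>
  then obtain z where z: "z \<in> A \<times> e" "\<And>z'. z' \<in> A \<times> e \<Longrightarrow> (\<lambda>(a, u). d a u) z \<le> (\<lambda>(a, u). d a u) z'"
    using ex_min_if_finite[of "(\<lambda>(a, u). d a u) ` (A \<times> e)"] by (fastforce simp: not_less)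
  obtain a u where au: "z = (a, u)" by fastforce
  then have a: "a \<in> A" and u: "u \<in> e" and min: "\<And>a' u'. a' \<in> A \<Longrightarrow> u' \<in> e \<Longrightarrow> d a u \<le> d a' u'"
    using z by auto
  obtain v where v: "e = {u, v}" using e0 u by auto
  have uvV: "u \<in> V" "v \<in> V" using edge_in_V[of u v] assms(4) v by auto
  have "(u, v) \<in> candidate_pairs V T A (near A) d"
  proof (cases "d a u \<le> 2 * Wmax")
    case True
    then have "u \<in> near A" using a uvV by (auto simp: near_def)
    then show ?thesis using uvV by (auto simp: candidate_pairs_def)
  next
    case False
    then obtain b where b: "b \<in> V" "d a b \<le> 2 * Wmax" "d b u < d a u - Wmax"
      using intermediate_vertex[of a u] a assms uvV by force
    \<comment> \<open>The saving of \<open>Wmax\<close> at \<open>b\<close> pays for crossing the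
      edge, so \<open>b\<close> is strictly closer than every center to both endpoints.\<close>
    have "d b v < d a u" using graph_dist_edge[of b u v] b assms v by force
    then have "u \<in> cluster V d A b" "v \<in> cluster V d A b"
      using b(3) assms(3) uvV min v by (fastforce simp: cluster_def)+
    moreover have "b \<in> near A" using a b by (auto simp: near_def)
    ultimately show ?thesis using uvV by (auto simp: candidate_pairs_def)
  qed
  then show ?thesis using v by blast
qed

text \<open>Every pair inspected belongs to the batch, so the default answer \<open>0\<close> is
  never read.\<close>

lemma near_from_answers:
  "{b \<in> V. \<exists>a\<in>A. (if Dist_Query a b \<in> dist_queries A V
      then answer V E w (Dist_Query a b) else 0) \<le> 2 * Wmax} = near A"
  by (auto simp: near_def)

lemma candidate_pairs_from_answers:
  assumes "A \<subseteq> V" "0 \<le> Wmax"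
  shows "candidate_pairs V T A (near A) (\<lambda>u v. if Dist_Query u v \<in> dist_queries (near A) V
      then answer V E w (Dist_Query u v) else 0) = candidate_pairs V T A (near A) d"
  using assms subset_near by (intro candidate_pairs_cong) auto

lemma reconstructs_all_pairs: "reconstructs V E w (ask_weights (V \<times> V))"
proof (rule reconstructs_ask_weights)
  fix e assume e: "e \<in> E"
  then obtain u v where "e = {u, v}" using edge_card by (meson card_2_iff)
  then show "\<exists>u v. e = {u, v} \<and> (u, v) \<in> V \<times> V" using e edge_in_V by blast
qed (use finite_V weight_bounds(1) in force)+

lemma reconstructs_from_centers:
  assumes "A \<subseteq> V" "A \<noteq> {}" "0 \<le> Wmax"
  shows "reconstructs V E w (reconstruct_from_centers V Wmax T A)"
proof -
  have fin: "finite A" "finite (near A)"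
    using assms finite_V near_subset finite_subset by blast+
  have "finite (candidate_pairs V T A (near A) d)"
    by (rule finite_subset[OF candidate_pairs_subset[OF near_subset]]) (simp add: finite_V)
  then have "reconstructs V E w (ask_weights (candidate_pairs V T A (near A) d))"
    using candidate_pairs_cover[OF assms] weight_bounds(1)
    by (intro reconstructs_ask_weights) force+
  then show ?thesis
    using fin finite_V assms
    by (simp only: reconstruct_from_centers_def reconstructs_ask_set finite_dist_queries Let_def
        near_from_answers candidate_pairs_from_answers)
qed

text \<open>Correctness holds for every draw: the induction only has to preserve that the centers
  are nonempty and that both sets stay inside \<open>V\<close>.\<close>

lemma reconstructs_center_rounds:
  assumes "A \<subseteq> V" "A \<noteq> {}" "W \<subseteq> V" "0 \<le> Wmax"
  shows "reconstructs V E w (center_rounds V Wmax m T j A W)"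
  using assms
proof (induction j arbitrary: A W)
  case 0
  then show ?case by (simp add: reconstructs_all_pairs reconstructs_from_centers)
next
  case (Suc j)
  have finW: "finite W" using Suc.prems finite_V finite_subset by blast
  have sub: "survivors d' W ys xs \<subseteq> V" for d' ys xs
    using Suc.prems(3) by (auto simp: survivors_def)
  show ?case
  proof (cases "W = {}")
    case True
    then show ?thesis using Suc.prems by (simp add: reconstructs_from_centers)
  next
    case False
    have "set ys \<subseteq> V" if "ys \<in> set_pmf (replicate_pmf (2 * m) (pmf_of_set W))" for ys
      using in_set_replicate_pmf_of_set(1)[OF that finW False] Suc.prems by blast
    then show ?thesis
      using False Suc.prems sub finite_V
      by (auto simp: reconstructs_Choose reconstructs_ask_set simp del: answer.simps
          intro!: Suc.IH sub Un_least)
  qed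
qed

text \<open>Each vertex of \<open>near A\<close> costs \<open>card V\<close> distance queries, and
  in the good case at most \<open>card V\<close> pairs in \<open>N \<times> V\<close> and
  \<open>T\<^sup>2\<close> pairs in its cluster. The last summand pays for the fallback.\<close>

lemma expected_queries_from_centers:
  assumes "A \<subseteq> V" "2 \<le> max_degree V E" "0 \<le> Wmax" "card A \<le> K"
  shows "expected_queries (answer V E w) (reconstruct_from_centers V Wmax T A) \<le>
    ennreal (real K * real (card V) +
      real K * (2 * real (max_degree V E) powr (2 * Wmax)) * (2 * real (card V) + (real T)\<^sup>2)) +
    of_nat ((card V)\<^sup>2 * card (large_settled V d T A {}))"
proof -
  let ?P = "candidate_pairs V T A (near A) d" and ?L = "card (large_settled V d T A {})"
  define \<beta> where "\<beta> = 2 * real (max_degree V E) powr (2 * Wmax)"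
  have \<beta>: "0 \<le> \<beta>" by (simp add: \<beta>_def)
  have fin: "finite A" "finite (near A)"
    using assms finite_V near_subset finite_subset by blast+
  have finP: "finite ?P"
    by (rule finite_subset[OF candidate_pairs_subset[OF near_subset]]) (simp add: finite_V)
  have "real (card (near A)) \<le> real (card A) * \<beta>"
    unfolding \<beta>_def by (rule card_near_le) (use assms in auto)
  also have "\<dots> \<le> real K * \<beta>" using assms \<beta> by (intro mult_right_mono) auto
  finally have N: "real (card (near A)) \<le> real K * \<beta>" .
  have "expected_queries (answer V E w) (reconstruct_from_centers V Wmax T A) =
      of_nat (card A * card V) + (of_nat (card (near A) * card V) + of_nat (card ?P))"
    using fin finite_V assms finP
    by (simp only: reconstruct_from_centers_def expected_queries_ask_set finite_dist_queries Let_def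
        near_from_answers candidate_pairs_from_answers card_dist_queries
        expected_queries_ask_weights)
  also have "\<dots> = of_nat (card A * card V + card (near A) * card V + card ?P)"
    by (simp add: add.assoc)
  also have "\<dots> \<le> of_nat ((card A * card V + card (near A) * (2 * card V + T\<^sup>2)) + (card V)\<^sup>2 * ?L)"
    using card_candidate_pairs[OF finite_V near_subset, of T A A d]
    by (intro of_nat_mono) (simp add: algebra_simps)
  also have "\<dots> = ennreal (real (card A * card V + card (near A) * (2 * card V + T\<^sup>2))) +
      of_nat ((card V)\<^sup>2 * ?L)"
    by (metis ennreal_of_nat_eq_real_of_nat of_nat_add)
  also have "\<dots> \<le> ennreal (real K * real (card V) + real K * \<beta> * (2 * real (card V) + (real T)\<^sup>2)) +
      of_nat ((card V)\<^sup>2 * ?L)"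
  proof (intro add_right_mono ennreal_leI)
    have "real (card A) * real (card V) \<le> real K * real (card V)"
      using assms by (intro mult_right_mono) auto
    moreover have "real (card (near A)) * (2 * real (card V) + (real T)\<^sup>2) \<le>
        real K * \<beta> * (2 * real (card V) + (real T)\<^sup>2)"
      using N by (intro mult_right_mono) auto
    ultimately show "real (card A * card V + card (near A) * (2 * card V + T\<^sup>2)) \<le>
        real K * real (card V) + real K * \<beta> * (2 * real (card V) + (real T)\<^sup>2)"
      by simp
  qed
  finally show ?thesis unfolding \<beta>_def .
qed

end

section \<open>Expected cost of the sampling rounds\<close>

context connected_weighted_graph
begin

text \<open>A potential argument. A round halves \<open>card W\<close> in expectation while the
  coefficient of \<open>card W\<close> doubles, so that term is preserved; the round itself adds
  \<open>m * card V\<close> queries and at most \<open>card V / 2 ^ s\<close> expected wrongly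
  dropped vertices. \<open>K\<close> bounds the number of centers after all remaining
  rounds.\<close>

lemma expected_queries_center_rounds:
  assumes "A \<subseteq> V" "W \<subseteq> V" "2 \<le> max_degree V E" "0 \<le> Wmax"
    and "card A + 2 * m * j \<le> K" "card V * s \<le> m * T"
    and F_def: "F = real K * real (card V) +
      real K * (2 * real (max_degree V E) powr (2 * Wmax)) * (2 * real (card V) + (real T)\<^sup>2)"
  shows "expected_queries (answer V E w) (center_rounds V Wmax m T j A W) \<le>
    ennreal (F + real j * (real (m * card V) + real (card V) ^ 3 / 2 ^ s)) +
    ennreal (real (card V) ^ 2 / 2 ^ j) * of_nat (card W) +
    ennreal (real (card V) ^ 2) * of_nat (card (large_settled V d T A W))"
  using assms(1,2,5)
proof (induction j arbitrary: A W)
  case 0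
  have F: "0 \<le> F" by (simp add: F_def)
  show ?case
  proof (cases "W = {}")
    case True
    then show ?thesis
      using expected_queries_from_centers[of A K T] 0 assms(3,4)
      by (simp add: F_def[symmetric] ennreal_of_nat_eq_real_of_nat ennreal_mult)
  next
    case False
    \<comment> \<open>After the last round a nonempty \<open>W\<close> forces all pairs to be asked,
      and the term with \<open>card W\<close> covers this.\<close>
    then have "1 \<le> card W" using 0 finite_V finite_subset by (metis card_gt_0_iff One_nat_def Suc_leI)
    then have "(of_nat (card V * card V) :: ennreal) \<le> of_nat (card V * card V * card W)"
      by (intro of_nat_mono) simp
    also have "\<dots> = ennreal (real (card V) ^ 2) * of_nat (card W)"
      by (simp add: ennreal_of_nat_eq_real_of_nat ennreal_mult power2_eq_square)
    finally show ?thesis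
      using False finite_V
      by (simp add: expected_queries_ask_weights card_cartesian_product add_increasing add_increasing2)
  qed
next
  case (Suc j)
  have F: "0 \<le> F" by (simp add: F_def)
  have finW: "finite W" using Suc.prems finite_V finite_subset by blast
  define R where "R = real (m * card V) + real (card V) ^ 3 / 2 ^ s"
  have R: "0 \<le> R" by (simp add: R_def)
  show ?case
  proof (cases "W = {}")
    case True
    have "expected_queries (answer V E w) (reconstruct_from_centers V Wmax T A) \<le>
        ennreal F + of_nat ((card V)\<^sup>2 * card (large_settled V d T A {}))"
      unfolding F_def by (rule expected_queries_from_centers) (use Suc.prems assms(3,4) in auto)
    also have "\<dots> \<le> ennreal (F + real (Suc j) * R) +
        ennreal (real (card V) ^ 2) * of_nat (card (large_settled V d T A {}))"
      using F R by (intro add_mono ennreal_leI) (auto simp: ennreal_of_nat_eq_real_of_nat ennreal_mult)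
    finally show ?thesis using True by (simp add: R_def)
  next
    case False
    let ?p = "replicate_pmf (2 * m) (pmf_of_set W)" and ?q = "replicate_pmf m (pmf_of_set V)"
    let ?n = "real (card V)"
    \<comment> \<open>\<open>c\<close> is the part of the cost not depending on the draw, and
      \<open>h\<close> the bound of the induction hypothesis as a function of the draw.\<close>
    define c where "c = ennreal (real (m * card V) + (F + real j * R))"
    define h where "h = (\<lambda>(ys, xs). c +
        ennreal (?n ^ 2 / 2 ^ j) * of_nat (card (survivors d W ys xs)) +
        ennreal (?n ^ 2) * of_nat (card (large_settled V d T (A \<union> set ys) (survivors d W ys xs))))"
    have branch: "expected_queries (answer V E w) (ask_set (dist_queries V (set xs)) (\<lambda>f.
        center_rounds V Wmax m T j (A \<union> set ys) (survivors (\<lambda>u v. f (Dist_Query u v)) W ys xs)))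
        \<le> h (ys, xs)"
      if "ys \<in> set_pmf ?p" "xs \<in> set_pmf ?q" for ys xs
    proof -
      note ys = in_set_replicate_pmf_of_set[OF that(1) finW False]
      note xs = in_set_replicate_pmf_of_set[OF that(2) finite_V V_nonempty]
      have surv: "survivors (\<lambda>u v. if Dist_Query u v \<in> dist_queries V (set xs)
          then answer V E w (Dist_Query u v) else 0) W ys xs = survivors d W ys xs"
        using ys Suc.prems by (intro survivors_cong[of W V]) auto
      have "card (A \<union> set ys) \<le> card A + card (set ys)" by (rule card_Un_le)
      also have "\<dots> \<le> card A + 2 * m" using ys card_length[of ys] by simp
      finally have "card (A \<union> set ys) + 2 * m * j \<le> K" using Suc.prems by simp
      then have IH: "expected_queries (answer V E w)
          (center_rounds V Wmax m T j (A \<union> set ys) (survivors d W ys xs)) \<le>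
        ennreal (F + real j * R) + ennreal (?n ^ 2 / 2 ^ j) * of_nat (card (survivors d W ys xs)) +
        ennreal (?n ^ 2) * of_nat (card (large_settled V d T (A \<union> set ys) (survivors d W ys xs)))"
        unfolding R_def using ys Suc.prems by (intro Suc.IH) (auto simp: survivors_def)
      have "card (dist_queries V (set xs)) \<le> m * card V"
        using card_length[of xs] xs by (simp add: card_dist_queries mult.commute)
      then have "(of_nat (card (dist_queries V (set xs))) :: ennreal) \<le> of_nat (m * card V)"
        by (rule of_nat_mono)
      also have "\<dots> = ennreal (real (m * card V))" by (rule ennreal_of_nat_eq_real_of_nat)
      finally have "of_nat (card (dist_queries V (set xs))) + expected_queries (answer V E w)
          (center_rounds V Wmax m T j (A \<union> set ys) (survivors d W ys xs)) \<le>
        ennreal (real (m * card V)) + (ennreal (F + real j * R) +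
          ennreal (?n ^ 2 / 2 ^ j) * of_nat (card (survivors d W ys xs)) +
          ennreal (?n ^ 2) * of_nat (card (large_settled V d T (A \<union> set ys) (survivors d W ys xs))))"
        using IH by (rule add_mono)
      also have "\<dots> = h (ys, xs)"
        unfolding h_def c_def prod.case using F R by (subst ennreal_plus) (auto simp: add.assoc)
      finally show ?thesis
        using finite_V by (simp only: expected_queries_ask_set finite_dist_queries List.finite_set surv)
    qed
    have halved: "(\<integral>\<^sup>+ z. of_nat (card (survivors d W (fst z) (snd z))) \<partial>measure_pmf (pair_pmf ?p ?q))
        \<le> ennreal (real (card W) / 2)"
      unfolding nn_integral_pair_pmf_swap fst_conv snd_conv
      using in_set_replicate_pmf_of_set(2)[OF _ finite_V V_nonempty] finW False
      by (intro nn_integral_pmf_const_bound expected_card_survivors) auto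
    have lost: "(\<integral>\<^sup>+ z. of_nat (card (large_settled V d T (A \<union> set (fst z))
        (survivors d W (fst z) (snd z)))) \<partial>measure_pmf (pair_pmf ?p ?q))
        \<le> of_nat (card (large_settled V d T A W)) + ennreal (?n / 2 ^ s)"
      unfolding nn_integral_pair_pmf' fst_conv snd_conv
      using finite_V V_nonempty Suc.prems assms(6)
      by (intro nn_integral_pmf_const_bound expected_card_large_settled) auto
    have "expected_queries (answer V E w) (center_rounds V Wmax m T (Suc j) A W) \<le>
        (\<integral>\<^sup>+ z. h z \<partial>measure_pmf (pair_pmf ?p ?q))"
      using False branch
      by (auto simp: expected_queries_Choose AE_measure_pmf_iff simp del: replicate_pmf.simps
          intro!: nn_integral_mono_AE)
    also have "\<dots> = c +
        ennreal (?n ^ 2 / 2 ^ j) * (\<integral>\<^sup>+ z. of_nat (card (survivors d W (fst z) (snd z)))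
          \<partial>measure_pmf (pair_pmf ?p ?q)) +
        ennreal (?n ^ 2) * (\<integral>\<^sup>+ z. of_nat (card (large_settled V d T (A \<union> set (fst z))
          (survivors d W (fst z) (snd z)))) \<partial>measure_pmf (pair_pmf ?p ?q))"
      by (simp add: h_def case_prod_unfold nn_integral_add nn_integral_cmult
          measure_pmf.emeasure_space_1)
    also have "\<dots> \<le> c + ennreal (?n ^ 2 / 2 ^ j) * ennreal (real (card W) / 2) +
        ennreal (?n ^ 2) * (of_nat (card (large_settled V d T A W)) + ennreal (?n / 2 ^ s))"
      by (intro add_mono mult_left_mono halved lost) auto
    also have "\<dots> = ennreal (F + real (Suc j) * R) +
        ennreal (?n ^ 2 / 2 ^ Suc j) * of_nat (card W) +
        ennreal (?n ^ 2) * of_nat (card (large_settled V d T A W))"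
    proof -
      \<comment> \<open>The factor 1/2 from halving moves into the power of 2, and
        \<open>?n ^ 2 * (?n / 2 ^ s)\<close> together with \<open>m * card V\<close> makes up one
        more \<open>R\<close>.\<close>
      have "real (m * card V) + (F + real j * R) + ?n ^ 2 / 2 ^ j * (real (card W) / 2) +
          ?n ^ 2 * (real (card (large_settled V d T A W)) + ?n / 2 ^ s) =
        F + real (Suc j) * R + ?n ^ 2 / 2 ^ Suc j * real (card W) +
          ?n ^ 2 * real (card (large_settled V d T A W))"
        by (simp add: R_def algebra_simps add_divide_distrib power2_eq_square power3_eq_cube)
      then show ?thesis
        using F R unfolding c_def ennreal_of_nat_eq_real_of_nat
        by (simp only: ennreal_plus[symmetric] ennreal_mult[symmetric] add_nonneg_nonneg
            mult_nonneg_nonneg divide_nonneg_nonneg of_nat_0_le_iff zero_le_power zero_le_numeral)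
    qed
    finally show ?thesis by (simp add: R_def)
  qed
qed

text \<open>Two distinct edges at one vertex need three vertices. This later gives
  \<open>ln n\<close> at least 1, so that constants can be absorbed into it.\<close>

lemma three_le_card:
  assumes "2 \<le> max_degree V E"
  shows "3 \<le> card V" "1 \<le> Wmax"
proof -
  have "max_degree V E \<in> degree E ` V"
    unfolding max_degree_def using finite_V V_nonempty by (intro Max_in) auto
  then obtain v where v: "2 \<le> card {e \<in> E. v \<in> e}" using assms by (auto simp: degree_def)
  then obtain e where "e \<in> E" by (metis (lifting) Collect_empty_eq card.empty not_numeral_le_zero)
  then show "1 \<le> Wmax" using weight_bounds by force
  show "3 \<le> card V"
  proof (rule ccontr)
    assume "\<not> 3 \<le> card V"
    then have "e = V" if "e \<in> E" for e
      using that graph finite_V card_mono[of V e] card_subset_eq[of V e]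
      by (auto simp: weighted_graph_def)
    then have "card {e \<in> E. v \<in> e} \<le> card {V}" by (intro card_mono) auto
    then show False using v by simp
  qed
qed

end

text \<open>The total cost with \<open>1 + 4 * m * L\<close> centers, cluster threshold
  \<open>2 * m * L\<close> and \<open>2 * L\<close> rounds. Each summand is compared with
  \<open>X = m ^ 3 * L ^ 3\<close>, the second one also carrying the factor \<beta>.\<close>

lemma cost_bound:
  fixes n m L \<beta> :: real
  assumes "1 \<le> m" "1 \<le> L" "2 \<le> \<beta>" "0 \<le> n" "n \<le> m\<^sup>2" and r: "r \<le> n"
  shows "(1 + 4 * m * L) * n + (1 + 4 * m * L) * \<beta> * (2 * n + (2 * m * L)\<^sup>2) +
    2 * L * (m * n + r) + r \<le> 40 * m ^ 3 * L ^ 3 * \<beta>"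
proof -
  have mL: "1 \<le> m * L" using assms mult_mono[of 1 m 1 L] by simp
  have K: "1 + 4 * m * L \<le> 5 * (m * L)" using mL unfolding mult.assoc by linarith
  have L2: "1 \<le> L\<^sup>2" using assms by (simp add: one_le_power)
  have n: "n \<le> m\<^sup>2 * L\<^sup>2" using assms L2 mult_mono[of n "m\<^sup>2" 1 "L\<^sup>2"] by simp
  have m2: "m\<^sup>2 * L\<^sup>2 \<le> m ^ 3 * L ^ 3"
    using mult_right_mono[OF mL, of "m\<^sup>2 * L\<^sup>2"] assms
    by (simp add: power2_eq_square power3_eq_cube algebra_simps)
  define X where "X = m ^ 3 * L ^ 3"
  have X: "0 \<le> X" using assms by (simp add: X_def)
  have 1: "(1 + 4 * m * L) * n \<le> 5 * X"
    using mult_mono[OF K n] mL assms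
    by (simp add: X_def power2_eq_square power3_eq_cube algebra_simps)
  have "2 * n + (2 * m * L)\<^sup>2 \<le> 6 * (m\<^sup>2 * L\<^sup>2)" using n by (simp add: power_mult_distrib mult.commute)
  from mult_mono[OF K this] have "(1 + 4 * m * L) * (2 * n + (2 * m * L)\<^sup>2) \<le> 30 * X"
    using mL assms by (simp add: X_def power2_eq_square power3_eq_cube algebra_simps)
  from mult_left_mono[OF this, of \<beta>]
  have 2: "(1 + 4 * m * L) * \<beta> * (2 * n + (2 * m * L)\<^sup>2) \<le> 30 * X * \<beta>"
    using assms by (simp add: mult_ac)
  have "m * n \<le> m * m\<^sup>2" using assms by (intro mult_left_mono) auto
  moreover have "n \<le> m * n" using assms mult_right_mono[of 1 m n] by simp
  ultimately have "m * n + r \<le> m * m\<^sup>2 + m * m\<^sup>2" using r by linarith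
  then have "2 * L * (m * n + r) \<le> 2 * L * (2 * m ^ 3)"
    using assms by (intro mult_left_mono) (auto simp: power3_eq_cube power2_eq_square)
  also have "\<dots> \<le> 4 * X"
    using assms L2 mult_left_mono[of 1 "L\<^sup>2" "m ^ 3 * L"]
    by (simp add: X_def power2_eq_square power3_eq_cube algebra_simps)
  finally have 3: "2 * L * (m * n + r) \<le> 4 * X" .
  have 4: "r \<le> X" using r n m2 by (simp add: X_def)
  \<comment> \<open>The summands without \<beta> total \<open>5 + 4 + 1\<close> times
    \<open>X\<close>, and \<beta> at least 2 absorbs them, giving \<open>35 * X * \<beta>\<close> in
    all.\<close>
  have "10 * X \<le> 5 * X * \<beta>" using X assms mult_left_mono[of 2 \<beta> "5 * X"] by simp
  moreover have "0 \<le> X * \<beta>" using X assms by simp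
  ultimately show ?thesis using 1 2 3 4 by (simp add: X_def[symmetric] mult.assoc)
qed

section \<open>Choice of parameters and the final estimate\<close>

theorem theorem3:
  "\<exists>(alg :: 'v set \<Rightarrow> real \<Rightarrow> ('v, 'v set set \<times> ('v set \<Rightarrow> real)) query_alg) (C :: real) (k :: nat).
     \<forall>(V :: 'v set) (E :: 'v set set) (w :: 'v set \<Rightarrow> real) (Wmax :: real) (n :: nat) (D :: nat).
       weighted_graph V E w Wmax \<and> connected_graph V E \<and>
       n = card V \<and> D = max_degree V E \<and> D \<ge> 2 \<longrightarrow>
         reconstructs V E w (alg V Wmax) \<and>
         expected_queries (answer V E w) (alg V Wmax)
           \<le> ennreal (C * ln (real n) ^ k * (real n powr (3/2) * real D powr (3 * Wmax)))"
proof -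
  \<comment> \<open>About \<open>sqrt n\<close> test vertices per round and \<open>2 * L\<close>
    rounds, with \<open>L\<close> about \<open>log 2 n\<close>. One arbitrary initial center keeps
    the set of centers nonempty.\<close>
  define m where "m = (\<lambda>V :: 'v set. nat \<lceil>sqrt (real (card V))\<rceil>)"
  define L where "L = (\<lambda>V :: 'v set. nat \<lceil>log 2 (real (card V))\<rceil>)"
  define alg :: "'v set \<Rightarrow> real \<Rightarrow> ('v, 'v set set \<times> ('v set \<Rightarrow> real)) query_alg"
    where "alg = (\<lambda>V Wmax. center_rounds V Wmax (m V) (2 * m V * L V) (2 * L V) {SOME v. v \<in> V} V)"
  \<comment> \<open>The constant is \<open>40 * 2 ^ 3 * 3 ^ 3 * 2\<close>, from
    \<open>cost_bound\<close>, \<open>M \<le> 2 * sqrt n\<close>, \<open>l \<le> 3 * ln n\<close>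
    and the factor 2 in \<beta>.\<close>
  have "reconstructs V E w (alg V Wmax) \<and>
      expected_queries (answer V E w) (alg V Wmax) \<le>
        ennreal (17280 * ln (real n) ^ 3 * (real n powr (3/2) * real D powr (3 * Wmax)))"
    if "weighted_graph V E w Wmax" "connected_graph V E"
      and n: "n = card V" and D: "D = max_degree V E" and "2 \<le> D"
    for V :: "'v set" and E :: "'v set set" and w Wmax n D
  proof
    interpret connected_weighted_graph V E w Wmax by unfold_locales (fact that)+
    have D2: "2 \<le> max_degree V E" using that by simp
    have n3: "3 \<le> real n" and W1: "1 \<le> Wmax" using three_le_card[OF D2] n by auto
    have v: "{SOME v. v \<in> V} \<subseteq> V" using V_nonempty some_in_eq by auto
    show "reconstructs V E w (alg V Wmax)"
      unfolding alg_def using v W1 by (intro reconstructs_center_rounds) auto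
    define M where "M = real (m V)"
    define l where "l = real (L V)"
    \<comment> \<open>\<open>r\<close> is the charge for vertices left in \<open>W\<close> at the
      end and, with \<open>s = 2 * L V\<close>, also the charge per round for wrongly dropped ones.
      Since \<open>2 ^ L V\<close> is at least \<open>n\<close>, it is at most
      \<open>n\<close>.\<close>
    define r where "r = real n ^ 3 / 2 ^ (2 * L V)"
    define \<beta> where "\<beta> = 2 * real D powr (2 * Wmax)"
    have sqrt1: "1 \<le> sqrt (real n)" using n3 by simp
    have M_ge: "sqrt (real n) \<le> M" unfolding M_def m_def n by (rule real_nat_ceiling_ge)
    have M_le: "M \<le> 2 * sqrt (real n)"
    proof -
      have "M \<le> sqrt (real n) + 1"
        unfolding M_def m_def n[symmetric] by (simp add: of_nat_nat ceiling_correct le_of_int_ceiling)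
      then show ?thesis using sqrt1 by linarith
    qed
    have M1: "1 \<le> M" using M_ge sqrt1 by linarith
    have nM: "real n \<le> M\<^sup>2" using M_ge real_sqrt_le_iff[of "real n" "M\<^sup>2"] M1 by simp
    have log_pos: "0 < log 2 (real n)" using n3 by simp
    have l_ge: "log 2 (real n) \<le> l" unfolding l_def L_def n by (rule real_nat_ceiling_ge)
    have l1: "1 \<le> l" using l_ge log_pos unfolding l_def by (cases "L V") auto
    have ln1: "1 \<le> ln (real n)"
    proof -
      have "exp 1 \<le> real n" using exp_le n3 by linarith
      then show ?thesis using n3 by (simp add: ln_ge_iff)
    qed
    have l_le: "l \<le> 3 * ln (real n)"
    proof -
      have "l \<le> log 2 (real n) + 1"
        unfolding l_def L_def n[symmetric] using log_pos by (simp add: of_nat_nat)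
      moreover have "log 2 (real n) \<le> 3 / 2 * ln (real n)"
      proof -
        have "ln (real n) * 1 \<le> ln (real n) * (3 / 2 * ln 2)"
          using ln2_ge_two_thirds ln1 by (intro mult_left_mono) auto
        then show ?thesis by (simp add: log_def field_simps)
      qed
      ultimately show ?thesis using ln1 by linarith
    qed
    have nL: "real n \<le> 2 ^ L V"
    proof -
      have "real n = 2 powr log 2 (real n)" using n3 by simp
      also have "\<dots> \<le> 2 powr l" using l_ge by simp
      also have "\<dots> = 2 ^ L V" by (simp add: l_def powr_realpow)
      finally show ?thesis .
    qed
    have r: "r \<le> real n" "0 \<le> r"
    proof -
      have "real n ^ 2 \<le> (2 ^ L V) ^ 2" using nL by (intro power_mono) auto
      then have "real n * real n ^ 2 \<le> real n * 2 ^ (2 * L V)"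
        by (intro mult_left_mono) (auto simp: power_mult[symmetric] mult.commute)
      then show "r \<le> real n" by (simp add: r_def divide_le_eq power3_eq_cube power2_eq_square)
    qed (simp add: r_def)
    have \<beta>: "2 \<le> \<beta>" unfolding \<beta>_def using \<open>2 \<le> D\<close> W1 by (simp add: ge_one_powr_ge_zero)
    \<comment> \<open>With \<open>s = 2 * L V\<close> and \<open>T = 2 * m V * L V\<close>, the
      sampling condition reduces to \<open>n \<le> m\<^sup>2\<close>.\<close>
    have "card V * (2 * L V) \<le> m V * (2 * m V * L V)"
    proof -
      have "real (card V) \<le> real (m V * m V)" using nM by (simp add: M_def n power2_eq_square)
      then have "card V \<le> m V * m V" by (simp only: of_nat_le_iff)
      then have "card V * (2 * L V) \<le> m V * m V * (2 * L V)" by (rule mult_le_mono1)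
      then show ?thesis by (simp add: mult_ac)
    qed
    \<comment> \<open>Initially \<open>W = V\<close>, so nothing has been settled and this term of
      the potential vanishes.\<close>
    moreover have "large_settled V d T A V = {}" for T A by (simp add: large_settled_def)
    ultimately have "expected_queries (answer V E w) (alg V Wmax) \<le>
      ennreal ((real (1 + 4 * m V * L V) * real (card V) +
        real (1 + 4 * m V * L V) * (2 * real (max_degree V E) powr (2 * Wmax)) *
          (2 * real (card V) + (real (2 * m V * L V))\<^sup>2)) +
        real (2 * L V) * (real (m V * card V) + real (card V) ^ 3 / 2 ^ (2 * L V))) +
      ennreal (real (card V) ^ 2 / 2 ^ (2 * L V)) * of_nat (card V)"
      unfolding alg_def
      using expected_queries_center_rounds[OF v order_refl D2 _ _ _ refl,
          of "m V" "2 * L V" "1 + 4 * m V * L V" "2 * L V" "2 * m V * L V"] W1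
      by simp
    also have "\<dots> = ennreal ((1 + 4 * M * l) * real n +
        (1 + 4 * M * l) * \<beta> * (2 * real n + (2 * M * l)\<^sup>2) + 2 * l * (M * real n + r) + r)"
    proof -
      have r': "real (card V) ^ 2 / 2 ^ (2 * L V) * real (card V) = r"
        by (simp add: r_def n power2_eq_square power3_eq_cube)
      show ?thesis
        unfolding ennreal_of_nat_eq_real_of_nat
        by (subst ennreal_mult[symmetric], simp, simp, subst r', subst ennreal_plus[symmetric])
          (auto simp: r M_def l_def \<beta>_def r_def n D mult.assoc)
    qed
    also have "\<dots> \<le> ennreal (17280 * ln (real n) ^ 3 * (real n powr (3/2) * real D powr (3 * Wmax)))"
    proof (rule ennreal_leI)
      have "(1 + 4 * M * l) * real n +
          (1 + 4 * M * l) * \<beta> * (2 * real n + (2 * M * l)\<^sup>2) + 2 * l * (M * real n + r) + r \<le>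
        40 * M ^ 3 * l ^ 3 * \<beta>"
        using M1 l1 \<beta> nM r by (intro cost_bound) auto
      also have "\<dots> \<le> 40 * (2 * sqrt (real n)) ^ 3 * (3 * ln (real n)) ^ 3 * \<beta>"
        using M1 l1 M_le l_le \<beta> by (intro mult_mono power_mono) auto
      also have "\<dots> = 17280 * ln (real n) ^ 3 * (sqrt (real n) ^ 3 * real D powr (2 * Wmax))"
        by (simp add: \<beta>_def power_mult_distrib)
      also have "sqrt (real n) ^ 3 = real n powr (3/2)"
        using n3 by (simp add: powr_half_sqrt[symmetric] powr_power)
      \<comment> \<open>The argument yields exponent \<open>2 * Wmax\<close>; monotonicity of powers
        of \<open>D\<close> gives the stated \<open>3 * Wmax\<close>.\<close>
      also have "17280 * ln (real n) ^ 3 * (real n powr (3/2) * real D powr (2 * Wmax)) \<le>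
          17280 * ln (real n) ^ 3 * (real n powr (3/2) * real D powr (3 * Wmax))"
        using ln1 \<open>2 \<le> D\<close> W1 by (intro mult_left_mono powr_mono) auto
      finally show "(1 + 4 * M * l) * real n +
          (1 + 4 * M * l) * \<beta> * (2 * real n + (2 * M * l)\<^sup>2) + 2 * l * (M * real n + r) + r \<le>
        17280 * ln (real n) ^ 3 * (real n powr (3/2) * real D powr (3 * Wmax))" .
    qed
    finally show "expected_queries (answer V E w) (alg V Wmax) \<le>
      ennreal (17280 * ln (real n) ^ 3 * (real n powr (3/2) * real D powr (3 * Wmax)))" .
  qed
  then show ?thesis by blast
qed

end
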